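(* Let $\mathbb{O}$ be the real division algebra of octonions, $p\mathbb{O}$ the paraoctonion algebra and $\mathcal{O}$ the real (division) Okubo algebra. Let $\mathbb{O}H^2$, $p\mathbb{O}H^2$ and $\mathcal{O}H^2$ be the hyperbolic incidence planes defined from Veronese-like vectors over these algebras with parameters $(\gamma_1,\gamma_2,\gamma_3)=(1,1,-1)$. Then these three incidence planes are isomorphic: $$\mathcal{O}H^2\cong p\mathbb{O}H^2\cong\mathbb{O}H^2 .$$
   Context: **Octonions.** $\mathbb{O}$ is the real octonion algebra with basis $e_0=1,e_1,\dots,e_7$, where $e_k^2=-1$ for $k\ge1$, distinct imaginary units anticommute, and $e_ie_{i+1}=e_{i+3}$, $e_{i+1}e_{i+3}=e_i$, $e_{i+3}e_i=e_{i+1}$ (indices in $\{1,\dots,7\}$ modulo $7$). Its product is denoted $x\cdot y$. Conjugation $x\mapsto\overline{x}$ fixes $1$ and sends $e_k\mapsto-e_k$ for $k\ge1$. The norm $n$ is given by $n(x)1=x\cdot\overline{x}$. Write $\langle x,y\rangle=n(x+y)-n(x)-n(y)$. **Paraoctonions.** $p\mathbb{O}$ is the vector space $\mathbb{O}$ with the same norm $n$ and the product $x\bullet y=\overline{x}\cdot\overline{y}$. **Okubo algebra.** Let $\tau:\mathbb{O}\to\mathbb{O}$ be the order-three automorphism given by $\tau(e_k)=e_k$ for $k=0,1,3,7$ and $$\tau(e_2)=-\tfrac12(e_2-\sqrt3 e_5),\quad \tau(e_5)=-\tfrac12(e_5+\sqrt3 e_2),\quad \tau(e_4)=-\tfrac12(e_4-\sqrt3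 e_6),\quad \tau(e_6)=-\tfrac12(e_6+\sqrt3 e_4).$$ $\mathcal{O}$ is the vector space $\mathbb{O}$ with the same norm $n$ and the product $x*y=\tau(\overline{x})\cdot\tau^2(\overline{y})$. **Veronese-like vectors.** Put $(\gamma_1,\gamma_2,\gamma_3)=(1,1,-1)$. For $\mathbb{K}$ one of these three algebras, let $V=\mathbb{K}^3\times\mathbb{R}^3$, with elements $(x_1,x_2,x_3;\lambda_1,\lambda_2,\lambda_3)$. In all cases a Veronese-like vector is a nonzero vector satisfying the norm conditions $$n(x_1)=\gamma_3\gamma_2^{-1}\lambda_2\lambda_3,\quad n(x_2)=\gamma_1\gamma_3^{-1}\lambda_3\lambda_1,\quad n(x_3)=\gamma_2\gamma_1^{-1}\lambda_1\lambda_2$$ together with the following. - If $\mathbb{K}=\mathbb{O}$: $\lambda_1\overline{x}_1=\gamma_3\gamma_2^{-1}x_2\cdot x_3$, $\lambda_2\overline{x}_2=\gamma_1\gamma_3^{-1}x_3\cdot x_1$, $\lambda_3\overline{x}_3=\gamma_2\gamma_1^{-1}x_1\cdot x_2$. - If $\mathbb{K}\in\{p\mathbb{O},\mathcal{O}\}$ with product $\circ$ ($\circ=\bullet$ or $\circ=*$ respectively): $\lambda_1x_1=\gamma_3\gamma_2^{-1}x_2\circ x_3$, $\lambda_2x_2=\gamma_1\gamma_3^{-1}x_3\circ x_1$, $\lambda_3x_3=\gamma_2\gamma_1^{-1}x_1\circ x_2$. **The incidence planes.** The points of $\mathbb{K}H^2$ are the one-dimensional subspaces $\mathbb{R}w\subset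 V$ with $w$ Veronese-like. The lines are the subspaces $w^\perp=\{z\in V:\beta(z,w)=0\}$ with $w$ Veronese-like, where for $x=(x_\nu;\lambda_\nu)_\nu$ and $y=(y_\nu;\mu_\nu)_\nu$, $$\beta(x,y)=\sum_{\nu=1}^3\big(\gamma_{\nu+2}^{-1}\gamma_{\nu+1}\langle x_\nu,y_\nu\rangle+\lambda_\nu\mu_\nu\big),$$ with indices of $\gamma$ taken modulo $3$. A point is incident with a line iff it is contained in it. **Isomorphism.** An isomorphism of incidence planes is a pair of bijections, points to points and lines to lines, such that a point is incident with a line if and only if their images are incident. *)

theory Defs
  imports "HOL-Analysis.Analysis"
begin

(* Octonion coordinates are indexed by "7 option": None is the index of the unit e_0 = 1 and
   Some k that of e_k, with k in the ring type 7 of integers modulo 7, so that the numeral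
   7 :: 7 equals 0 and index arithmetic is modulo 7. *)
type_synonym octo = "real ^ 7 option"

lemma exhaust_7: "(x::7) = 1 \<or> x = 2 \<or> x = 3 \<or> x = 4 \<or> x = 5 \<or> x = 6 \<or> x = 7"
proof (induct x)
  case (of_int z)
  then have "0 \<le> z" "z < 7" by simp_all
  then have "z = 0 \<or> z = 1 \<or> z = 2 \<or> z = 3 \<or> z = 4 \<or> z = 5 \<or> z = 6" by arith
  then show ?case by auto
qed

lemma UNIV_7: "(UNIV::7 set) = {1, 2, 3, 4, 5, 6, 7}"
  using exhaust_7 by auto

lemma forall_7: "(\<forall>x::7. P x) \<longleftrightarrow> P 1 \<and> P 2 \<and> P 3 \<and> P 4 \<and> P 5 \<and> P 6 \<and> P 7"
proof -
  have "(\<forall>x::7. P x) \<longleftrightarrow> (\<forall>x\<in>UNIV. P x)" by (rule ball_UNIV [symmetric])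
  then show ?thesis unfolding UNIV_7 by (simp only: ball_simps simp_thms)
qed

lemma sum_octo_index:
  fixes f :: "7 option \<Rightarrow> 'a::ab_group_add"
  shows "(\<Sum>i\<in>UNIV. f i) = f None + f (Some 1) + f (Some 2) + f (Some 3) + f (Some 4)
    + f (Some 5) + f (Some 6) + f (Some 7)"
proof -
  have "(\<Sum>k\<in>UNIV. f (Some k)) = f (Some 1) + (f (Some 2) + (f (Some 3) + (f (Some 4)
      + (f (Some 5) + (f (Some 6) + f (Some 7))))))"
    unfolding UNIV_7 by simp
  moreover have "(\<Sum>i\<in>UNIV. f i) = f None + (\<Sum>k\<in>UNIV. f (Some k))"
    by (simp add: UNIV_option_conv sum.reindex)
  ultimately show ?thesis by (simp only: add.assoc)
qed

definition octo_one :: octo where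
  "octo_one = axis None 1"

definition octo_unit :: "7 \<Rightarrow> octo" where
  "octo_unit k = axis (Some k) 1"

(* The differences j - i = 1, 2, 4 are those in the rules e_k e_(k+1) = e_(k+3),
   e_(k+1) e_(k+3) = e_k and e_(k+3) e_k = e_(k+1), solved for k; the remaining differences
   follow by anticommutativity. See octo_unit_mult_table below. *)
definition octo_unit_mult :: "7 \<Rightarrow> 7 \<Rightarrow> octo" where
  "octo_unit_mult i j =
    (if j = i then - octo_one
     else if j = i + 1 then octo_unit (i + 3)
     else if j = i + 2 then octo_unit (i - 1)
     else if j = i + 4 then octo_unit (i - 2)
     else if i = j + 1 then - octo_unit (j + 3)
     else if i = j + 2 then - octo_unit (j - 1)
     else - octo_unit (j - 2))"

lemma octo_unit_mult_table:
  "octo_unit_mult i (i + 1) = octo_unit (i + 3)"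
  "octo_unit_mult (i + 1) (i + 3) = octo_unit i"
  "octo_unit_mult (i + 3) i = octo_unit (i + 1)"
  "i \<noteq> j \<Longrightarrow> octo_unit_mult i j = - octo_unit_mult j i"
  "octo_unit_mult i i = - octo_one"
  using exhaust_7[of i] exhaust_7[of j] by (auto simp: octo_unit_mult_def)

fun octo_basis_mult :: "7 option \<Rightarrow> 7 option \<Rightarrow> octo" where
  "octo_basis_mult None j = axis j 1"
| "octo_basis_mult (Some i) None = octo_unit i"
| "octo_basis_mult (Some i) (Some j) = octo_unit_mult i j"

definition octo_mult :: "octo \<Rightarrow> octo \<Rightarrow> octo"  (infixl "\<odot>" 70) where
  "x \<odot> y = (\<Sum>i\<in>UNIV. \<Sum>j\<in>UNIV. (x $ i * y $ j) *\<^sub>R octo_basis_mult i j)"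

definition octo_cnj :: "octo \<Rightarrow> octo" where
  "octo_cnj x = (\<chi> i. case i of None \<Rightarrow> x $ None | Some k \<Rightarrow> - x $ Some k)"

(* The coefficient of 1 in x \<odot> octo_cnj x; see octo_norm_one below. *)
definition octo_norm :: "octo \<Rightarrow> real" where
  "octo_norm x = (x \<odot> octo_cnj x) $ None"

lemma octo_norm_one: "octo_norm x *\<^sub>R octo_one = x \<odot> octo_cnj x"
  unfolding octo_norm_def octo_mult_def sum_octo_index octo_cnj_def
  by (simp add: octo_unit_mult_def octo_one_def octo_unit_def vec_eq_iff
      split_option_all forall_7 axis_def)

definition octo_polar :: "octo \<Rightarrow> octo \<Rightarrow> real" where
  "octo_polar x y = octo_norm (x + y) - octo_norm x - octo_norm y"

fun octo_tau_basis :: "7 option \<Rightarrow> octo" where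
  "octo_tau_basis None = octo_one"
| "octo_tau_basis (Some k) =
    (if k = 2 then (- 1 / 2) *\<^sub>R (octo_unit 2 - sqrt 3 *\<^sub>R octo_unit 5)
     else if k = 5 then (- 1 / 2) *\<^sub>R (octo_unit 5 + sqrt 3 *\<^sub>R octo_unit 2)
     else if k = 4 then (- 1 / 2) *\<^sub>R (octo_unit 4 - sqrt 3 *\<^sub>R octo_unit 6)
     else if k = 6 then (- 1 / 2) *\<^sub>R (octo_unit 6 + sqrt 3 *\<^sub>R octo_unit 4)
     else octo_unit k)"

definition octo_tau :: "octo \<Rightarrow> octo" where
  "octo_tau x = (\<Sum>i\<in>UNIV. x $ i *\<^sub>R octo_tau_basis i)"

definition para_mult :: "octo \<Rightarrow> octo \<Rightarrow> octo" where
  "para_mult x y = octo_cnj x \<odot> octo_cnj y"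

definition okubo_mult :: "octo \<Rightarrow> octo \<Rightarrow> octo" where
  "okubo_mult x y = octo_tau (octo_cnj x) \<odot> octo_tau (octo_tau (octo_cnj y))"

(* The three algebras share their underlying vector space and norm, so they share V.
   Indices 1, 2, 3 live in the ring type 3 of integers modulo 3, where 3 = 0. *)
type_synonym vspace = "(octo ^ 3) \<times> (real ^ 3)"

definition gam :: "3 \<Rightarrow> real" where
  "gam \<nu> = (if \<nu> = 3 then - 1 else 1)"

definition norm_conditions :: "vspace \<Rightarrow> bool" where
  "norm_conditions w \<longleftrightarrow> (case w of (x, l) \<Rightarrow>
     \<forall>\<nu>. octo_norm (x $ \<nu>) =
         gam (\<nu> + 2) * inverse (gam (\<nu> + 1)) * (l $ (\<nu> + 1)) * (l $ (\<nu> + 2)))"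

definition octo_veronese :: "vspace \<Rightarrow> bool" where
  "octo_veronese w \<longleftrightarrow> w \<noteq> 0 \<and> norm_conditions w \<and> (case w of (x, l) \<Rightarrow>
     \<forall>\<nu>. (l $ \<nu>) *\<^sub>R octo_cnj (x $ \<nu>) =
         (gam (\<nu> + 2) * inverse (gam (\<nu> + 1))) *\<^sub>R (x $ (\<nu> + 1) \<odot> x $ (\<nu> + 2)))"

definition symm_veronese :: "(octo \<Rightarrow> octo \<Rightarrow> octo) \<Rightarrow> vspace \<Rightarrow> bool" where
  "symm_veronese mul w \<longleftrightarrow> w \<noteq> 0 \<and> norm_conditions w \<and> (case w of (x, l) \<Rightarrow>
     \<forall>\<nu>. (l $ \<nu>) *\<^sub>R x $ \<nu> =
         (gam (\<nu> + 2) * inverse (gam (\<nu> + 1))) *\<^sub>R mul (x $ (\<nu> + 1)) (x $ (\<nu> + 2)))"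

definition beta :: "vspace \<Rightarrow> vspace \<Rightarrow> real" where
  "beta v w = (case v of (x, l) \<Rightarrow> case w of (y, m) \<Rightarrow>
     \<Sum>\<nu>\<in>UNIV. inverse (gam (\<nu> + 2)) * gam (\<nu> + 1) * octo_polar (x $ \<nu>) (y $ \<nu>)
            + (l $ \<nu>) * (m $ \<nu>))"

record ('p, 'l) incidence_plane =
  points :: "'p set"
  lines :: "'l set"
  incident :: "'p \<Rightarrow> 'l \<Rightarrow> bool"

definition plane_isomorphic ::
    "('p, 'l) incidence_plane \<Rightarrow> ('q, 'm) incidence_plane \<Rightarrow> bool"  (infix "\<cong>\<^sub>p" 50) where
  "P \<cong>\<^sub>p Q \<longleftrightarrow> (\<exists>f g. bij_betw f (points P) (points Q) \<and> bij_betw g (lines P) (lines Q) \<and>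
     (\<forall>p\<in>points P. \<forall>l\<in>lines P. incident P p l \<longleftrightarrow> incident Q (f p) (g l)))"

definition veronese_plane :: "(vspace \<Rightarrow> bool) \<Rightarrow> (vspace set, vspace set) incidence_plane" where
  "veronese_plane ver =
     \<lparr>points = {span {w} |w. ver w},
      lines = {{z. beta z w = 0} |w. ver w},
      incident = (\<subseteq>)\<rparr>"

definition octo_H2 :: "(vspace set, vspace set) incidence_plane" where
  "octo_H2 = veronese_plane octo_veronese"

definition para_H2 :: "(vspace set, vspace set) incidence_plane" where
  "para_H2 = veronese_plane (symm_veronese para_mult)"

definition okubo_H2 :: "(vspace set, vspace set) incidence_plane" where
  "okubo_H2 = veronese_plane (symm_veronese okubo_mult)"

end

(* A bijective linear map of V acting on each octonion coordinate by a norm-preserving map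
   preserves beta, so it carries points to points and lines to lines as soon as it respects the
   Veronese conditions. Conjugating every coordinate turns the paraoctonionic conditions into the
   octonionic ones. As tau is an automorphism of order three that commutes with conjugation,
   applying tau^nu to x_nu turns x_(nu+1) * x_(nu+2) into a paraoctonionic product: the exponents
   must increase by one from each coordinate to the next, which is consistent around the cycle
   because tau^3 = 1. *)

theory Submission
  imports Defs
begin

lemma octo_eq_iff:
  fixes x y :: octo
  shows "x = y \<longleftrightarrow> x $ None = y $ None \<and> x $ Some 1 = y $ Some 1 \<and> x $ Some 2 = y $ Some 2
    \<and> x $ Some 3 = y $ Some 3 \<and> x $ Some 4 = y $ Some 4 \<and> x $ Some 5 = y $ Some 5
    \<and> x $ Some 6 = y $ Some 6 \<and> x $ Some 7 = y $ Some 7"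
  by (simp only: vec_eq_iff split_option_all forall_7)

text \<open>Offsets up to 6 from an index in 1, ..., 7 give numerals up to 13; these are brought
  back to the representatives used in \<open>octo_eq_iff\<close>.\<close>

lemma index_7_reduce:
  "(8::7) = 1" "(9::7) = 2" "(10::7) = 3" "(11::7) = 4" "(12::7) = 5" "(13::7) = 6"
  by simp_all

text \<open>In the imaginary coordinates, the three differences come from solving each of the rules
  for e_i e_(i+1), e_(i+1) e_(i+3) and e_(i+3) e_i for the index k of the result; the minus signs
  are anticommutativity.\<close>

lemma octo_mult_nth:
  "(x \<odot> y) $ None = x$None * y$None - x$Some 1 * y$Some 1 - x$Some 2 * y$Some 2
     - x$Some 3 * y$Some 3 - x$Some 4 * y$Some 4 - x$Some 5 * y$Some 5
     - x$Some 6 * y$Some 6 - x$Some 7 * y$Some 7"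
  "(x \<odot> y) $ Some k = x$None * y$Some k + x$Some k * y$None
     + x$Some (k + 4) * y$Some (k + 5) - x$Some (k + 5) * y$Some (k + 4)
     + x$Some (k + 1) * y$Some (k + 3) - x$Some (k + 3) * y$Some (k + 1)
     + x$Some (k + 2) * y$Some (k + 6) - x$Some (k + 6) * y$Some (k + 2)"
proof -
  show "(x \<odot> y) $ None = x$None * y$None - x$Some 1 * y$Some 1 - x$Some 2 * y$Some 2
     - x$Some 3 * y$Some 3 - x$Some 4 * y$Some 4 - x$Some 5 * y$Some 5
     - x$Some 6 * y$Some 6 - x$Some 7 * y$Some 7"
    unfolding octo_mult_def sum_octo_index
    by (simp add: octo_unit_mult_def octo_one_def octo_unit_def axis_def)
  show "(x \<odot> y) $ Some k = x$None * y$Some k + x$Some k * y$None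
     + x$Some (k + 4) * y$Some (k + 5) - x$Some (k + 5) * y$Some (k + 4)
     + x$Some (k + 1) * y$Some (k + 3) - x$Some (k + 3) * y$Some (k + 1)
     + x$Some (k + 2) * y$Some (k + 6) - x$Some (k + 6) * y$Some (k + 2)"
    unfolding octo_mult_def sum_octo_index
    using exhaust_7[of k]
    by (elim disjE) (simp_all add: index_7_reduce octo_unit_mult_def octo_one_def octo_unit_def axis_def)
qed

lemma octo_cnj_nth:
  "octo_cnj x $ None = x $ None"
  "octo_cnj x $ Some k = - x $ Some k"
  by (simp_all add: octo_cnj_def)

lemma octo_cnj_cnj [simp]: "octo_cnj (octo_cnj x) = x"
  by (simp add: octo_eq_iff octo_cnj_nth)

lemma linear_octo_cnj: "linear octo_cnj"
  by (rule linearI) (simp_all add: octo_eq_iff octo_cnj_nth)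

lemma octo_norm_cnj: "octo_norm (octo_cnj x) = octo_norm x"
  unfolding octo_norm_def octo_mult_nth octo_cnj_nth by simp

text \<open>Tau rotates the planes (e_2, e_5) and (e_4, e_6) by 2 pi / 3 and fixes the other
  coordinates.\<close>

lemma octo_tau_nth:
  "octo_tau x $ None = x $ None"
  "octo_tau x $ Some 1 = x $ Some 1"
  "octo_tau x $ Some 2 = - (x $ Some 2) / 2 - sqrt 3 / 2 * x $ Some 5"
  "octo_tau x $ Some 3 = x $ Some 3"
  "octo_tau x $ Some 4 = - (x $ Some 4) / 2 - sqrt 3 / 2 * x $ Some 6"
  "octo_tau x $ Some 5 = - (x $ Some 5) / 2 + sqrt 3 / 2 * x $ Some 2"
  "octo_tau x $ Some 6 = - (x $ Some 6) / 2 + sqrt 3 / 2 * x $ Some 4"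
  "octo_tau x $ Some 7 = x $ Some 7"
  unfolding octo_tau_def sum_octo_index
  by (simp_all add: octo_one_def octo_unit_def axis_def algebra_simps)

lemma linear_octo_tau: "linear octo_tau"
  by (rule linearI) (simp_all add: octo_eq_iff octo_tau_nth field_simps)

lemma octo_tau_cnj: "octo_tau (octo_cnj x) = octo_cnj (octo_tau x)"
  by (simp add: octo_eq_iff octo_tau_nth octo_cnj_nth)

lemma octo_tau_tau_tau: "octo_tau (octo_tau (octo_tau x)) = x"
proof -
  \<comment> \<open>Products are normalised to the right, so the square of \<open>sqrt 3\<close>
    occurs in front of a further factor.\<close>
  have [simp]: "sqrt 3 * (sqrt 3 * t) = 3 * t" for t
    by (simp flip: mult.assoc)
  show ?thesis
    by (simp add: octo_eq_iff octo_tau_nth field_simps)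
qed

lemma octo_tau_mult: "octo_tau (x \<odot> y) = octo_tau x \<odot> octo_tau y"
proof -
  have [simp]: "sqrt 3 * (sqrt 3 * t) = 3 * t" for t
    by (simp flip: mult.assoc)
  show ?thesis
    by (simp add: octo_eq_iff octo_mult_nth octo_tau_nth index_7_reduce) (simp add: field_simps)
qed

text \<open>The norm is the coefficient of 1 in x times its conjugate; tau commutes with both
  operations and fixes that coefficient.\<close>

lemma octo_norm_tau: "octo_norm (octo_tau x) = octo_norm x"
  by (simp add: octo_norm_def octo_tau_nth flip: octo_tau_cnj octo_tau_mult)

text \<open>The map may vary with the coordinate, as the powers of tau will. The real entries stay
  fixed, so the right-hand sides of the norm conditions do not change.\<close>

definition coordwise :: "(3 \<Rightarrow> octo \<Rightarrow> octo) \<Rightarrow> vspace \<Rightarrow> vspace" where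
  "coordwise h w = (\<chi> \<nu>. h \<nu> (fst w $ \<nu>), snd w)"

lemma linear_coordwise:
  assumes "\<And>\<nu>. linear (h \<nu>)"
  shows "linear (coordwise h)"
  by (rule linearI)
    (simp_all add: coordwise_def prod_eq_iff vec_eq_iff linear_add[OF assms] linear_scale[OF assms])

lemma bij_coordwise:
  assumes "\<And>\<nu>. bij (h \<nu>)"
  shows "bij (coordwise h)"
proof (rule o_bij)
  show "coordwise (\<lambda>\<nu>. inv (h \<nu>)) \<circ> coordwise h = id"
    using assms by (auto simp: fun_eq_iff coordwise_def vec_eq_iff bij_is_inj)
  show "coordwise h \<circ> coordwise (\<lambda>\<nu>. inv (h \<nu>)) = id"
    using assms by (auto simp: fun_eq_iff coordwise_def vec_eq_iff bij_is_surj surj_f_inv_f)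
qed

lemma beta_coordwise:
  assumes "\<And>\<nu>. linear (h \<nu>)" and "\<And>\<nu> x. octo_norm (h \<nu> x) = octo_norm x"
  shows "beta (coordwise h v) (coordwise h w) = beta v w"
proof -
  have "octo_polar (h \<nu> x) (h \<nu> y) = octo_polar x y" for \<nu> x y
    by (simp add: octo_polar_def assms(2) flip: linear_add[OF assms(1)])
  then show ?thesis
    by (simp add: beta_def coordwise_def split_beta)
qed

lemma norm_conditions_coordwise:
  assumes "\<And>\<nu> x. octo_norm (h \<nu> x) = octo_norm x"
  shows "norm_conditions (coordwise h w) \<longleftrightarrow> norm_conditions w"
  by (simp add: norm_conditions_def coordwise_def split_beta assms)

lemma coordwise_eq_0_iff:
  assumes "\<And>\<nu>. linear (h \<nu>)" and "\<And>\<nu>. bij (h \<nu>)"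
  shows "coordwise h w = 0 \<longleftrightarrow> w = 0"
  using linear_injective_0 linear_coordwise[of h] bij_coordwise[of h] assms
  by (metis bij_is_inj linear_0)

text \<open>Taking images under \<open>\<phi>\<close> serves as the bijection both on points and on
  lines.\<close>

lemma veronese_plane_isomorphic:
  assumes lin: "linear \<phi>" and bij: "bij \<phi>"
    and beta: "\<And>v w. beta (\<phi> v) (\<phi> w) = beta v w"
    and ver: "\<And>w. ver' (\<phi> w) \<longleftrightarrow> ver w"
  shows "veronese_plane ver \<cong>\<^sub>p veronese_plane ver'"
proof -
  have inj: "inj ((`) \<phi>)"
    using bij by (auto intro!: injI simp: inj_image_eq_iff bij_is_inj)
  have line: "\<phi> ` {z. beta z w = 0} = {z. beta z (\<phi> w) = 0}" for w
  proof (intro set_eqI iffI)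
    fix z assume "z \<in> {z. beta z (\<phi> w) = 0}"
    \<comment> \<open>Surjectivity is what makes the image of w's orthogonal space the whole
      orthogonal space of \<open>\<phi> w\<close>.\<close>
    moreover obtain v where "z = \<phi> v"
      using bij by (metis bij_pointE)
    ultimately show "z \<in> \<phi> ` {z. beta z w = 0}"
      by (simp add: beta)
  qed (auto simp: beta)
  \<comment> \<open>Spans and orthogonal spaces are both families \<open>F w\<close> that
    \<open>\<phi>\<close> carries to \<open>F (\<phi> w)\<close>, so one argument covers
    them.\<close>
  have families: "bij_betw ((`) \<phi>) {F w |w. ver w} {F w |w. ver' w}"
    if F: "\<And>w. \<phi> ` F w = F (\<phi> w)" for F :: "vspace \<Rightarrow> vspace set"
  proof -
    have "{w. ver' w} = \<phi> ` {w. ver w}"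
    proof (intro set_eqI iffI)
      fix w assume "w \<in> {w. ver' w}"
      moreover obtain v where "w = \<phi> v"
        using bij by (metis bij_pointE)
      ultimately show "w \<in> \<phi> ` {w. ver w}"
        by (simp add: ver)
    qed (auto simp: ver)
    then have "(`) \<phi> ` {F w |w. ver w} = {F w |w. ver' w}"
      by (simp only: setcompr_eq_image image_image F)
    with inj show ?thesis
      by (auto simp: bij_betw_def intro: inj_on_subset)
  qed
  have points: "bij_betw ((`) \<phi>) {span {w} |w. ver w} {span {w} |w. ver' w}"
    by (rule families) (simp flip: linear_span_image[OF lin])
  have lines: "bij_betw ((`) \<phi>) {{z. beta z w = 0} |w. ver w} {{z. beta z w = 0} |w. ver' w}"
    by (rule families) (rule line)
  have "p \<subseteq> l \<longleftrightarrow> \<phi> ` p \<subseteq> \<phi> ` l" for p l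
    using bij by (simp add: inj_image_subset_iff bij_is_inj)
  with points lines show ?thesis
    unfolding plane_isomorphic_def veronese_plane_def incidence_plane.simps by blast
qed

lemma para_H2_isomorphic_octo_H2: "para_H2 \<cong>\<^sub>p octo_H2"
  unfolding para_H2_def octo_H2_def
proof (rule veronese_plane_isomorphic)
  let ?h = "\<lambda>_::3. octo_cnj"
  have bij: "bij octo_cnj"
    by (rule o_bij[of octo_cnj]) (simp_all add: fun_eq_iff)
  show "linear (coordwise ?h)" "bij (coordwise ?h)"
    by (simp_all add: linear_coordwise linear_octo_cnj bij_coordwise bij)
  show "beta (coordwise ?h v) (coordwise ?h w) = beta v w" for v w
    by (simp add: beta_coordwise linear_octo_cnj octo_norm_cnj)
  \<comment> \<open>The double conjugate on the left cancels, and the product of conjugates on the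
    right is \<open>para_mult\<close>.\<close>
  show "octo_veronese (coordwise ?h w) \<longleftrightarrow> symm_veronese para_mult w" for w
    by (simp add: octo_veronese_def symm_veronese_def norm_conditions_coordwise octo_norm_cnj
        coordwise_eq_0_iff linear_octo_cnj bij) (simp add: coordwise_def split_beta para_mult_def)
qed

text \<open>The exponent is a natural number while \<nu> is a residue modulo 3, so representatives
  are chosen, with 0 for \<nu> = 3.\<close>

definition tau_pow :: "3 \<Rightarrow> octo \<Rightarrow> octo" where
  "tau_pow \<nu> = octo_tau ^^ (if \<nu> = 1 then 1 else if \<nu> = 2 then 2 else 0)"

lemma tau_pow_simps:
  "tau_pow 1 = octo_tau" "tau_pow 2 = octo_tau \<circ> octo_tau" "tau_pow 3 = id"
  by (simp_all add: tau_pow_def numeral_2_eq_2 fun_eq_iff)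

lemma linear_tau_pow: "linear (tau_pow \<nu>)"
  using exhaust_3[of \<nu>]
  by (auto simp only: tau_pow_simps intro!: linear_octo_tau linear_compose linear_id)

lemma bij_octo_tau: "bij octo_tau"
  by (rule o_bij[of "octo_tau \<circ> octo_tau"]) (simp_all add: fun_eq_iff octo_tau_tau_tau)

lemma bij_tau_pow: "bij (tau_pow \<nu>)"
  using exhaust_3[of \<nu>] by (auto simp only: tau_pow_simps intro!: bij_octo_tau bij_comp bij_id)

lemma octo_norm_tau_pow: "octo_norm (tau_pow \<nu> x) = octo_norm x"
  using exhaust_3[of \<nu>] by (auto simp only: tau_pow_simps octo_norm_tau o_apply id_apply)

text \<open>The Okubo product already carries exponents 1 and 2 on its factors; the automorphism
  tau^\<nu> raises both by \<nu>, modulo 3.\<close>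

lemma tau_pow_okubo_mult:
  "tau_pow \<nu> (okubo_mult x y) = para_mult (tau_pow (\<nu> + 1) x) (tau_pow (\<nu> + 2) y)"
proof -
  have "(3::3) + 1 = 1" "(3::3) + 2 = 2" "(2::3) + 1 = 3" "(2::3) + 2 = 1" "(1::3) + 1 = 2"
    "(1::3) + 2 = 3"
    by simp_all
  then show ?thesis
    using exhaust_3[of \<nu>]
    by (auto simp only: tau_pow_simps okubo_mult_def para_mult_def octo_tau_mult octo_tau_cnj
        octo_tau_tau_tau o_apply id_apply)
qed

lemma okubo_H2_isomorphic_para_H2: "okubo_H2 \<cong>\<^sub>p para_H2"
  unfolding okubo_H2_def para_H2_def
proof (rule veronese_plane_isomorphic)
  show "linear (coordwise tau_pow)" "bij (coordwise tau_pow)"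
    by (simp_all add: linear_coordwise linear_tau_pow bij_coordwise bij_tau_pow)
  show "beta (coordwise tau_pow v) (coordwise tau_pow w) = beta v w" for v w
    by (simp add: beta_coordwise linear_tau_pow octo_norm_tau_pow)
  \<comment> \<open>Applying the injective linear map tau^\<nu> to the Okubo condition at \<nu>
    gives an equivalent condition.\<close>
  have "l *\<^sub>R tau_pow \<nu> x = c *\<^sub>R para_mult (tau_pow (\<nu> + 1) y) (tau_pow (\<nu> + 2) z)
      \<longleftrightarrow> l *\<^sub>R x = c *\<^sub>R okubo_mult y z" for l c \<nu> x y z
    by (simp add: inj_eq[OF bij_is_inj[OF bij_tau_pow]]
        flip: tau_pow_okubo_mult linear_scale[OF linear_tau_pow])
  then show "symm_veronese para_mult (coordwise tau_pow w) \<longleftrightarrow> symm_veronese okubo_mult w" for w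
    by (simp add: symm_veronese_def norm_conditions_coordwise octo_norm_tau_pow
        coordwise_eq_0_iff linear_tau_pow bij_tau_pow) (simp add: coordwise_def split_beta)
qed

theorem mainTheorem2:
  shows "okubo_H2 \<cong>\<^sub>p para_H2 \<and> para_H2 \<cong>\<^sub>p octo_H2"
  using okubo_H2_isomorphic_para_H2 para_H2_isomorphic_octo_H2 by blast

end
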